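(* Let $S=K[x_1,\ldots,x_n]$ be a standard graded polynomial ring over a field $K$ and let $I$ be a nonzero proper equigenerated vertex splittable ideal of $S$. Then $\mathrm{v}(I^{k})=\alpha(I)k-1$ for all $k\geq 1$.
   Context: $S=\bigoplus_{d\ge 0}S_d$ is graded with $\deg x_i=1$. For a monomial ideal $J$, $\mathcal{G}(J)$ denotes its unique minimal set of monomial generators; $J$ is equigenerated if all elements of $\mathcal G(J)$ have the same degree. A monomial ideal $I$ in a polynomial ring $R=K[X]$ ($X$ a finite set of variables) is vertex splittable if it can be obtained by the following recursive procedure: (1) if $v$ is a monomial and $I=(v)$, or $I=(0)$, or $I=R$, then $I$ is vertex splittable; (2) if there are a variable $x\in X$ and vertex splittable ideals $I_1,I_2$ of $K[X\setminus\{x\}]$ such that $I=xI_1+I_2$ (with $I_1,I_2$ extended to $R$), $I_2\subseteq I_1$, and $\mathcal{G}(I)=\mathcal{G}(xI_1)\sqcup\mathcal{G}(I_2)$ (disjoint union), then $I$ is vertex splittable. For a nonzero graded ideal $I$, $\alpha(I):=\min\{\deg(f)\mid f\in I\setminus\{0\}\}$ (over homogeneous $f$). For a proper graded ideal $I$, $\mathrm{v}(I):=\min\{d\geq 0\mid \exists f\in S_d,\ \mathfrak{p}\in\operatorname{Ass}(I)\text{ with }(I:f)=\mathfrak{p}\}$, where $\operatorname{Ass}(I)$ is the set of associated primes of $S/I$ and $(I:f)=\{g\in S\mid gf\in I\}$. *)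

theory Defs
  imports "HOL-Library.Poly_Mapping" "HOL-Algebra.Ideal_Product" "HOL-Algebra.QuotRing"
begin

text \<open>
  A power product in variables from \<^typ>\<open>'x\<close> is an exponent vector \<^typ>\<open>'x \<Rightarrow>\<^sub>0 nat\<close>, and a
  polynomial is a finitely supported coefficient function on power products. For a set \<open>X\<close> of
  variables, \<open>poly_ring X\<close> is the polynomial ring \<open>K[X]\<close>, where \<open>K\<close> is the type \<open>'k\<close>. All the rings
  \<open>K[X]\<close> are subrings of one ring, so \<open>K[X - {x}] \<subseteq> K[X]\<close> is a literal inclusion of carriers.
\<close>

type_synonym ('x, 'k) mpoly = "('x \<Rightarrow>\<^sub>0 nat) \<Rightarrow>\<^sub>0 'k"

definition poly_ring :: "'x set \<Rightarrow> ('x, 'k::field) mpoly ring" where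
  "poly_ring X = \<lparr>carrier = {p. \<forall>m \<in> Poly_Mapping.keys p. Poly_Mapping.keys m \<subseteq> X},
                  monoid.mult = (*), one = 1, zero = 0, add = (+)\<rparr>"

lemma cring_poly_ring: "cring (poly_ring X :: ('x, 'k::field) mpoly ring)"
proof (rule cringI)
  let ?R = "poly_ring X :: ('x, 'k) mpoly ring"
  show "abelian_group ?R"
  proof (rule abelian_groupI)
    fix p q assume "p \<in> carrier ?R" "q \<in> carrier ?R"
    then show "p \<oplus>\<^bsub>?R\<^esub> q \<in> carrier ?R"
      using Poly_Mapping.keys_add[of p q] by (auto simp: poly_ring_def)
  next
    fix p assume "p \<in> carrier ?R"
    then have "- p \<in> carrier ?R" "- p \<oplus>\<^bsub>?R\<^esub> p = \<zero>\<^bsub>?R\<^esub>"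
      by (auto simp: poly_ring_def)
    then show "\<exists>q \<in> carrier ?R. q \<oplus>\<^bsub>?R\<^esub> p = \<zero>\<^bsub>?R\<^esub>" by blast
  qed (auto simp: poly_ring_def add.assoc add.commute)
  show "comm_monoid ?R"
  proof (rule comm_monoidI)
    fix p q assume pq: "p \<in> carrier ?R" "q \<in> carrier ?R"
    have "Poly_Mapping.keys m \<subseteq> X" if m: "m \<in> Poly_Mapping.keys (p * q)" for m
    proof -
      obtain a b where "m = a + b" "a \<in> Poly_Mapping.keys p" "b \<in> Poly_Mapping.keys q"
        using m Poly_Mapping.keys_mult[of p q] by auto
      then show ?thesis
        using Poly_Mapping.keys_add[of a b] pq by (fastforce simp: poly_ring_def)
    qed
    then show "p \<otimes>\<^bsub>?R\<^esub> q \<in> carrier ?R" by (auto simp: poly_ring_def)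
  qed (auto simp: poly_ring_def mult.assoc mult.commute)
qed (auto simp: poly_ring_def distrib_right)

definition variable :: "'x \<Rightarrow> ('x, 'k::field) mpoly" where
  "variable x = Poly_Mapping.single (Poly_Mapping.single x 1) 1"

definition monomials :: "'x set \<Rightarrow> ('x, 'k::field) mpoly set" where
  "monomials X = {Poly_Mapping.single m 1 | m. Poly_Mapping.keys m \<subseteq> X}"

text \<open>The homogeneous component of degree \<open>d\<close> of \<open>K[X]\<close>; it contains \<open>0\<close>.\<close>

definition hom_component :: "'x set \<Rightarrow> nat \<Rightarrow> ('x, 'k::field) mpoly set" where
  "hom_component X d =
     {p \<in> carrier (poly_ring X).
        \<forall>m \<in> Poly_Mapping.keys p. (\<Sum>x \<in> Poly_Mapping.keys m. Poly_Mapping.lookup m x) = d}"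

text \<open>The unique minimal set of monomial generators of a monomial ideal \<open>J\<close> of \<open>K[X]\<close>
  (unspecified if \<open>J\<close> is not a monomial ideal).\<close>

definition min_gens :: "'x set \<Rightarrow> ('x, 'k::field) mpoly set \<Rightarrow> ('x, 'k) mpoly set" where
  "min_gens X J =
     (THE G. G \<subseteq> monomials X \<and> genideal (poly_ring X) G = J \<and>
             (\<forall>H. H \<subset> G \<longrightarrow> genideal (poly_ring X) H \<noteq> J))"

definition equigenerated :: "'x set \<Rightarrow> ('x, 'k::field) mpoly set \<Rightarrow> bool" where
  "equigenerated X J \<longleftrightarrow> (\<exists>d. min_gens X J \<subseteq> hom_component X d)"

text \<open>In the rule \<open>split\<close>, \<open>J1\<close> and \<open>J2\<close> are the extensions of \<open>I1\<close> and \<open>I2\<close> to \<open>K[X]\<close>, and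
  \<open>variable x <#\<^bsub>poly_ring X\<^esub> J1\<close> is the ideal \<open>x J1\<close>.\<close>

inductive vertex_splittable :: "'x set \<Rightarrow> ('x, 'k::field) mpoly set \<Rightarrow> bool" where
  principal: "v \<in> monomials X \<Longrightarrow> vertex_splittable X (genideal (poly_ring X) {v})"
| zero: "vertex_splittable X {\<zero>\<^bsub>poly_ring X\<^esub>}"
| unit: "vertex_splittable X (carrier (poly_ring X))"
| split: "\<lbrakk>x \<in> X; vertex_splittable (X - {x}) I1; vertex_splittable (X - {x}) I2;
           J1 = genideal (poly_ring X) I1; J2 = genideal (poly_ring X) I2;
           I = (variable x <#\<^bsub>poly_ring X\<^esub> J1) <+>\<^bsub>poly_ring X\<^esub> J2;
           I2 \<subseteq> I1;
           min_gens X I = min_gens X (variable x <#\<^bsub>poly_ring X\<^esub> J1) \<union> min_gens X J2;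
           min_gens X (variable x <#\<^bsub>poly_ring X\<^esub> J1) \<inter> min_gens X J2 = {}\<rbrakk>
          \<Longrightarrow> vertex_splittable X I"

definition initial_degree :: "'x set \<Rightarrow> ('x, 'k::field) mpoly set \<Rightarrow> nat" where
  "initial_degree X I = (LEAST d. \<exists>f \<in> hom_component X d. f \<in> I \<and> f \<noteq> \<zero>\<^bsub>poly_ring X\<^esub>)"

definition colon :: "('a, 'b) ring_scheme \<Rightarrow> 'a set \<Rightarrow> 'a \<Rightarrow> 'a set" where
  "colon R I f = {g \<in> carrier R. g \<otimes>\<^bsub>R\<^esub> f \<in> I}"

text \<open>The associated primes of the \<open>R\<close>-module \<open>R/I\<close>: the primes of \<open>R\<close> that are annihilators of
  elements of \<open>R/I\<close>, where \<open>g\<close> acts on \<open>R/I\<close> as multiplication by its residue class \<open>I + g\<close>.\<close>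

definition associated_primes :: "('a, 'b) ring_scheme \<Rightarrow> 'a set \<Rightarrow> 'a set set" where
  "associated_primes R I =
     {P. primeideal P R \<and>
         (\<exists>m \<in> carrier (R Quot I).
            P = {g \<in> carrier R. (I +>\<^bsub>R\<^esub> g) \<otimes>\<^bsub>R Quot I\<^esub> m = \<zero>\<^bsub>R Quot I\<^esub>})}"

definition v_number :: "'x set \<Rightarrow> ('x, 'k::field) mpoly set \<Rightarrow> nat" where
  "v_number X I =
     (LEAST d. \<exists>f \<in> hom_component X d. \<exists>P \<in> associated_primes (poly_ring X) I.
                 colon (poly_ring X) I f = P)"

text \<open>\<open>ideals_set R\<close> is the monoid of ideals of \<open>R\<close> under the product of ideals.\<close>

abbreviation ideal_power ::
  "'x set \<Rightarrow> ('x, 'k::field) mpoly set \<Rightarrow> nat \<Rightarrow> ('x, 'k) mpoly set" where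
  "ideal_power X I k \<equiv> I [^]\<^bsub>ideals_set (poly_ring X)\<^esub> k"

end

theory Submission
  imports Defs "HOL-Library.Set_Algebras"
begin

text \<open>
  Write \<open>d = \<alpha>(I)\<close>; all minimal generators of \<open>I\<close> have degree \<open>d\<close>, so \<open>I\<^sup>k\<close> has no nonzero
  element of degree below \<open>dk\<close>. If a colon ideal \<open>(I\<^sup>k : f)\<close> is prime, it contains the monomials
  of \<open>I\<^sup>k\<close> and hence a variable \<open>x\<close>. Then \<open>x f\<close> is a nonzero element of \<open>I\<^sup>k\<close>, so that
  \<open>deg f \<ge> dk - 1\<close> (\<open>prime_colon_degree\<close>).

  For equality it suffices to find a monomial \<open>f\<close> of degree \<open>dk - 1\<close> such that \<open>(I\<^sup>k : f)\<close> is
  generated by variables. It is found by induction on the construction of \<open>I\<close>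
  (\<open>vertex_splittable_variable_colon\<close>). If \<open>I = (v)\<close>, take \<open>f = v\<^sup>k / x\<close> for a variable \<open>x\<close>
  dividing \<open>v\<close>. If \<open>I = x I\<^sub>1 + I\<^sub>2\<close> with \<open>I\<^sub>2 \<subseteq> I\<^sub>1\<close>, the key identity is
  \<open>(I\<^sup>k : x\<^sup>k) = I\<^sub>1\<^sup>k K[X]\<close> (\<open>split_colon_power\<close>). Since \<open>I\<^sub>1\<close> is generated in degree \<open>d - 1\<close>,
  a monomial \<open>f\<^sub>1\<close> of degree \<open>(d - 1)k - 1\<close> that works for \<open>I\<^sub>1\<close> gives \<open>f = x\<^sup>k f\<^sub>1\<close>. This fails
  only if \<open>I\<^sub>1\<close> is the unit ideal; then \<open>d = 1\<close>, the ideal \<open>I\<close> itself is generated by variables,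
  and \<open>(I\<^sup>k : x\<^bsup>k-1\<^esup>) = I\<close> for a variable \<open>x \<in> I\<close>.

  All ideals involved are monomial ideals. Such an ideal is the span of the monomials that it
  contains, so the whole recursion takes place on sets of exponent vectors, where sums of ideals
  become unions and products become sumsets.
\<close>

section \<open>Exponent vectors\<close>

abbreviation supp :: "('x \<Rightarrow>\<^sub>0 nat) \<Rightarrow> 'x set" where
  "supp m \<equiv> Poly_Mapping.keys m"

definition exponents :: "'x set \<Rightarrow> ('x \<Rightarrow>\<^sub>0 nat) set" where
  "exponents X = {m. supp m \<subseteq> X}"

definition degree_in :: "'x set \<Rightarrow> ('x \<Rightarrow>\<^sub>0 nat) \<Rightarrow> nat" where
  "degree_in V m = (\<Sum>x \<in> supp m \<inter> V. Poly_Mapping.lookup m x)"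

abbreviation total_degree :: "('x \<Rightarrow>\<^sub>0 nat) \<Rightarrow> nat" where
  "total_degree m \<equiv> degree_in UNIV m"

lemma supp_add: "supp (a + b) = supp a \<union> supp b"
  by (auto simp: in_keys_iff lookup_add)

lemma exponents_add [simp]: "a + b \<in> exponents X \<longleftrightarrow> a \<in> exponents X \<and> b \<in> exponents X"
  by (auto simp: exponents_def supp_add)

lemma zero_in_exponents [simp]: "0 \<in> exponents X"
  by (simp add: exponents_def)

lemma single_in_exponents [simp]: "x \<in> X \<Longrightarrow> Poly_Mapping.single x k \<in> exponents X"
  by (simp add: exponents_def)

lemma exponents_plus_exponents [simp]: "exponents X + exponents X = exponents X"
  using set_zero_plus2[OF zero_in_exponents] by (auto elim!: set_plus_elim)

lemma degree_in_superset:
  assumes "finite F" "supp m \<subseteq> F"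
  shows "degree_in V m = (\<Sum>x \<in> F \<inter> V. Poly_Mapping.lookup m x)"
  unfolding degree_in_def using assms
  by (intro sum.mono_neutral_left) (auto simp: in_keys_iff)

lemma degree_in_add: "degree_in V (a + b) = degree_in V a + degree_in V b"
  by (simp add: degree_in_superset[of "supp a \<union> supp b"] supp_add lookup_add sum.distrib)

lemma degree_in_zero [simp]: "degree_in V 0 = 0"
  by (simp add: degree_in_def)

lemma degree_in_single: "degree_in V (Poly_Mapping.single x k) = (if x \<in> V then k else 0)"
  by (simp add: degree_in_def)

lemma degree_in_pos_iff: "degree_in V m > 0 \<longleftrightarrow> supp m \<inter> V \<noteq> {}"
proof -
  have "degree_in V m = 0 \<longleftrightarrow> supp m \<inter> V = {}"
    by (auto simp: degree_in_def in_keys_iff)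
  then show ?thesis by (metis neq0_conv)
qed

lemma split_off_variable:
  assumes "x \<in> supp v"
  obtains w where "v = w + Poly_Mapping.single x 1"
proof
  show "v = Poly_Mapping.update x (Poly_Mapping.lookup v x - 1) v + Poly_Mapping.single x 1"
    using assms
    by (intro poly_mapping_eqI) (auto simp: lookup_add lookup_update lookup_single when_def in_keys_iff)
qed

lemma total_degree_one:
  assumes "total_degree m = 1"
  obtains x where "m = Poly_Mapping.single x 1"
proof -
  have "supp m \<noteq> {}" using assms degree_in_pos_iff[of UNIV m] by simp
  then obtain x where "x \<in> supp m" by blast
  then obtain w where w: "m = w + Poly_Mapping.single x 1" by (rule split_off_variable)
  then have "total_degree w = 0"
    using assms by (simp add: degree_in_add degree_in_single)
  then have "w = 0" using degree_in_pos_iff[of UNIV w] by simp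
  then show ?thesis using w that by simp
qed


section \<open>Exponent sets of monomial ideals\<close>

definition exponent_ideal :: "'x set \<Rightarrow> ('x \<Rightarrow>\<^sub>0 nat) set \<Rightarrow> bool" where
  "exponent_ideal X M \<longleftrightarrow> M \<subseteq> exponents X \<and> M + exponents X = M"

definition minimal_exponents :: "('x \<Rightarrow>\<^sub>0 nat) set \<Rightarrow> ('x \<Rightarrow>\<^sub>0 nat) set" where
  "minimal_exponents M = {m \<in> M. \<forall>a \<in> M. \<forall>b. m = a + b \<longrightarrow> b = 0}"

text \<open>The exponent set of the \<open>k\<close>-th power of a monomial ideal; the value at \<open>k = 0\<close> is the
  exponent set of the unit ideal.\<close>

primrec sumset_power :: "'x set \<Rightarrow> ('x \<Rightarrow>\<^sub>0 nat) set \<Rightarrow> nat \<Rightarrow> ('x \<Rightarrow>\<^sub>0 nat) set" where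
  "sumset_power X M 0 = exponents X"
| "sumset_power X M (Suc k) = sumset_power X M k + M"

lemma exponent_idealD:
  assumes "exponent_ideal X M"
  shows "m \<in> M \<Longrightarrow> m \<in> exponents X" and "m \<in> M \<Longrightarrow> b \<in> exponents X \<Longrightarrow> m + b \<in> M"
  using assms unfolding exponent_ideal_def by (auto intro: set_plus_intro)

lemma exponent_ideal_exponents: "exponent_ideal X (exponents X)"
  by (simp add: exponent_ideal_def)

lemma exponent_ideal_generated:
  assumes "A \<subseteq> exponents X"
  shows "exponent_ideal X (A + exponents X)"
  using set_plus_mono2[OF assms order_refl[of "exponents X"]]
  by (simp add: exponent_ideal_def add.assoc)

lemma exponent_ideal_plus:
  assumes "exponent_ideal X A" "exponent_ideal X B"
  shows "exponent_ideal X (A + B)"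
  using assms set_plus_mono2[of A "exponents X" B "exponents X"]
  by (simp add: exponent_ideal_def add.assoc)

lemma exponent_ideal_Un:
  assumes "exponent_ideal X A" "exponent_ideal X B"
  shows "exponent_ideal X (A \<union> B)"
  using assms by (auto simp: exponent_ideal_def Un_set_plus)

lemma exponent_ideal_sumset_power:
  assumes "exponent_ideal X M"
  shows "exponent_ideal X (sumset_power X M k)"
  by (induction k) (auto intro: exponent_ideal_exponents exponent_ideal_plus assms)

lemma minimal_exponent_below:
  assumes M: "exponent_ideal X M"
  shows "m \<in> M \<Longrightarrow> \<exists>a \<in> minimal_exponents M. \<exists>b \<in> exponents X. m = a + b"
proof (induction "total_degree m" arbitrary: m rule: less_induct)
  case less
  show ?case
  proof (cases "m \<in> minimal_exponents M")
    case True
    then show ?thesis by (metis add.right_neutral zero_in_exponents)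
  next
    case False
    then obtain a b where ab: "a \<in> M" "m = a + b" "b \<noteq> 0"
      using less.prems by (auto simp: minimal_exponents_def)
    have bX: "b \<in> exponents X" using exponent_idealD(1)[OF M less.prems] ab by simp
    have "total_degree b > 0" using ab by (simp add: degree_in_pos_iff)
    then have "total_degree a < total_degree m" using ab by (simp add: degree_in_add)
    then obtain c e where "c \<in> minimal_exponents M" "e \<in> exponents X" "a = c + e"
      using less.hyps ab(1) by blast
    then show ?thesis using ab bX by (metis add.assoc exponents_add)
  qed
qed

lemma generated_by_minimal_exponents:
  assumes M: "exponent_ideal X M"
  shows "minimal_exponents M + exponents X = M"
proof
  show "minimal_exponents M + exponents X \<subseteq> M"
  proof
    fix m assume "m \<in> minimal_exponents M + exponents X"
    then obtain a b where "m = a + b" "a \<in> minimal_exponents M" "b \<in> exponents X"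
      by (rule set_plus_elim)
    then show "m \<in> M" using exponent_idealD(2)[OF M] by (simp add: minimal_exponents_def)
  qed
  show "M \<subseteq> minimal_exponents M + exponents X"
    using minimal_exponent_below[OF M] by (metis set_plus_intro subsetI)
qed

lemma generated_degree_le:
  assumes M: "exponent_ideal X M" and d: "minimal_exponents M \<subseteq> {m. total_degree m = d}"
    and m: "m \<in> M"
  shows "d \<le> total_degree m"
  using minimal_exponent_below[OF M m] d by (fastforce simp: degree_in_add)

lemma sumset_power_degree_le:
  assumes "\<And>m. m \<in> M \<Longrightarrow> d \<le> degree_in V m"
  shows "m \<in> sumset_power X M k \<Longrightarrow> d * k \<le> degree_in V m"
proof (induction k arbitrary: m)
  case (Suc k)
  then obtain a b where "m = a + b" "a \<in> sumset_power X M k" "b \<in> M"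
    by (auto elim: set_plus_elim)
  then show ?case
    using Suc.IH[of a] assms[of b] by (simp add: degree_in_add)
qed simp


section \<open>Colon ideals of powers that are generated by variables\<close>

text \<open>On the level of exponents, this says that the colon ideal of the monomial ideal with exponent
  set \<open>N\<close> by the monomial with exponent \<open>f\<close> is the prime ideal generated by the variables in \<open>V\<close>.\<close>

definition variable_colon :: "'x set \<Rightarrow> ('x \<Rightarrow>\<^sub>0 nat) set \<Rightarrow> ('x \<Rightarrow>\<^sub>0 nat) \<Rightarrow> 'x set \<Rightarrow> bool" where
  "variable_colon X N f V \<longleftrightarrow> f \<in> exponents X \<and> V \<subseteq> X \<and>
     (\<forall>m \<in> exponents X. m + f \<in> N \<longleftrightarrow> supp m \<inter> V \<noteq> {})"

text \<open>If \<open>I = (v)\<close> and \<open>x\<close> divides \<open>v\<close>, then \<open>(I\<^sup>k : v\<^sup>k / x) = (x)\<close>.\<close>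

lemma variable_colon_principal:
  assumes v: "v \<in> exponents X" "v \<noteq> 0" and k: "k \<ge> 1"
  shows "\<exists>f V. variable_colon X (sumset_power X ({v} + exponents X) k) f V \<and>
               total_degree f + 1 = total_degree v * k"
proof -
  obtain x where x: "x \<in> supp v" using v(2) by (metis all_not_in_conv keys_eq_empty)
  then have xX: "x \<in> X" using v(1) by (auto simp: exponents_def)
  obtain w where w: "v = w + Poly_Mapping.single x 1" using split_off_variable[OF x] .
  obtain j where j: "k = Suc j" using k by (cases k) auto
  define s where "s = (\<lambda>i::nat. \<Sum>_<i. v)"
  have s_Suc: "s (Suc i) = s i + v" for i by (simp add: s_def)
  have s_X: "s i \<in> exponents X" for i by (induction i) (use v in \<open>auto simp: s_Suc, simp add: s_def\<close>)
  have s_deg: "total_degree (s i) = total_degree v * i" for i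
    by (induction i) (simp_all add: s_Suc degree_in_add, simp add: s_def)
  have power: "sumset_power X ({v} + exponents X) i = {s i} + exponents X" for i
  proof (induction i)
    case 0
    then show ?case by (simp add: s_def)
  next
    case (Suc i)
    have "sumset_power X ({v} + exponents X) (Suc i) = ({s i} + {v}) + (exponents X + exponents X)"
      using Suc by (simp only: sumset_power.simps ac_simps)
    also have "{s i} + {v} = {s (Suc i)}" by (auto simp: s_Suc set_plus_def)
    finally show ?case by simp
  qed
  have "m + (s j + w) \<in> sumset_power X ({v} + exponents X) k \<longleftrightarrow> supp m \<inter> {x} \<noteq> {}"
    if m: "m \<in> exponents X" for m
  proof -
    have "m + (s j + w) \<in> sumset_power X ({v} + exponents X) k \<longleftrightarrow>
          (\<exists>b \<in> exponents X. m + (s j + w) = s j + (w + Poly_Mapping.single x 1) + b)"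
      unfolding power j s_Suc w[symmetric] by (auto simp: set_plus_def)
    also have "\<dots> \<longleftrightarrow> (\<exists>b \<in> exponents X. (s j + w) + m = (s j + w) + (Poly_Mapping.single x 1 + b))"
      by (simp only: ac_simps)
    also have "\<dots> \<longleftrightarrow> (\<exists>b \<in> exponents X. m = Poly_Mapping.single x 1 + b)"
      by (simp only: add_left_cancel)
    also have "\<dots> \<longleftrightarrow> x \<in> supp m"
    proof
      assume "x \<in> supp m"
      then obtain b where "m = b + Poly_Mapping.single x 1" by (rule split_off_variable)
      then show "\<exists>b \<in> exponents X. m = Poly_Mapping.single x 1 + b"
        using m by (metis add.commute exponents_add)
    qed (auto simp: supp_add)
    finally show ?thesis by simp
  qed
  moreover have "w \<in> exponents X" using v(1) w by simp
  moreover have "total_degree (s j + w) + 1 = total_degree v * k"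
    using arg_cong[OF w, of total_degree]
    by (simp add: degree_in_add degree_in_single s_deg j)
  ultimately show ?thesis
    using xX s_X by (intro exI[of _ "s j + w"] exI[of _ "{x}"]) (auto simp: variable_colon_def)
qed

text \<open>An ideal \<open>I\<close> generated by variables satisfies \<open>(I\<^sup>k : x\<^bsup>k-1\<^esup>) = I\<close> for every variable \<open>x \<in> I\<close>,
  as the degree of a monomial in the variables of \<open>I\<close> decides which powers of \<open>I\<close> contain it.\<close>

lemma variable_colon_linear:
  assumes M: "exponent_ideal X M" "M \<noteq> {}"
    and lin: "minimal_exponents M \<subseteq> {m. total_degree m = 1}" and k: "k \<ge> 1"
  shows "\<exists>f V. variable_colon X (sumset_power X M k) f V \<and> total_degree f + 1 = k"
proof -
  define V where "V = {x \<in> X. Poly_Mapping.single x 1 \<in> M}"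
  have M_V: "m \<in> M \<longleftrightarrow> supp m \<inter> V \<noteq> {}" if m: "m \<in> exponents X" for m
  proof
    assume "m \<in> M"
    then obtain a b where ab: "a \<in> minimal_exponents M" "m = a + b"
      using minimal_exponent_below[OF M(1)] by blast
    then have "total_degree a = 1" using lin by auto
    then obtain x where x: "a = Poly_Mapping.single x 1" by (rule total_degree_one)
    then have "a \<in> M" "x \<in> supp m" using ab by (auto simp: minimal_exponents_def supp_add)
    then show "supp m \<inter> V \<noteq> {}" using x m by (auto simp: V_def exponents_def)
  next
    assume "supp m \<inter> V \<noteq> {}"
    then obtain x where x: "x \<in> supp m" "Poly_Mapping.single x 1 \<in> M" by (auto simp: V_def)
    then obtain b where "m = b + Poly_Mapping.single x 1" by (blast elim: split_off_variable)
    then show "m \<in> M" using x m exponent_idealD(2)[OF M(1) x(2), of b] by (simp add: add.commute)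
  qed
  obtain m0 where "m0 \<in> M" using M(2) by blast
  then have "supp m0 \<inter> V \<noteq> {}" using M_V exponent_idealD(1)[OF M(1)] by blast
  then obtain x where x: "x \<in> X" "x \<in> V" "Poly_Mapping.single x 1 \<in> M" by (auto simp: V_def)
  obtain j where j: "k = Suc j" using k by (cases k) auto
  have mem: "m \<in> M \<Longrightarrow> m + Poly_Mapping.single x i \<in> sumset_power X M (Suc i)" for m i
  proof (induction i)
    case 0
    then show ?case using set_plus_intro[OF zero_in_exponents, of m M] by simp
  next
    case (Suc i)
    have "(m + Poly_Mapping.single x i) + Poly_Mapping.single x 1 \<in> sumset_power X M (Suc i) + M"
      using Suc x by (intro set_plus_intro) auto
    then show ?case by (simp add: add.assoc single_add[symmetric] del: single_one)
  qed
  have "m + Poly_Mapping.single x j \<in> sumset_power X M k \<longleftrightarrow> supp m \<inter> V \<noteq> {}"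
    if m: "m \<in> exponents X" for m
  proof
    assume "supp m \<inter> V \<noteq> {}"
    then show "m + Poly_Mapping.single x j \<in> sumset_power X M k"
      unfolding j using mem M_V m by blast
  next
    assume *: "m + Poly_Mapping.single x j \<in> sumset_power X M k"
    \<comment> \<open>Every monomial of \<open>I\<^sup>k\<close> has degree at least \<open>k\<close> in \<open>V\<close>, and \<open>x\<^bsup>k-1\<^esup>\<close> contributes only \<open>k - 1\<close>.\<close>
    have "1 \<le> degree_in V a" if "a \<in> M" for a
      using degree_in_pos_iff[of V a] M_V that exponent_idealD(1)[OF M(1)] by fastforce
    then have "1 * k \<le> degree_in V (m + Poly_Mapping.single x j)"
      using * by (rule sumset_power_degree_le)
    then have "degree_in V m > 0" using x j by (simp add: degree_in_add degree_in_single)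
    then show "supp m \<inter> V \<noteq> {}" by (simp add: degree_in_pos_iff)
  qed
  then show ?thesis
    using x(1) j by (intro exI[of _ "Poly_Mapping.single x j"] exI[of _ V])
      (auto simp: variable_colon_def degree_in_single V_def)
qed

text \<open>The exponent set of \<open>x I\<^sub>1 + I\<^sub>2\<close>, where \<open>I\<^sub>1\<close> and \<open>I\<^sub>2\<close> are extended to \<open>K[X]\<close>.\<close>

definition split_exponents ::
  "'x \<Rightarrow> 'x set \<Rightarrow> ('x \<Rightarrow>\<^sub>0 nat) set \<Rightarrow> ('x \<Rightarrow>\<^sub>0 nat) set \<Rightarrow> ('x \<Rightarrow>\<^sub>0 nat) set" where
  "split_exponents x X A B =
     ({Poly_Mapping.single x 1} + (A + exponents X)) \<union> (B + exponents X)"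

lemma exponent_ideal_split:
  assumes "A \<subseteq> exponents X" "B \<subseteq> exponents X" "x \<in> X"
  shows "exponent_ideal X (split_exponents x X A B)"
proof -
  have "{Poly_Mapping.single x 1} + A \<subseteq> exponents X"
    using assms by (auto elim!: set_plus_elim)
  then show ?thesis
    unfolding split_exponents_def add.assoc[symmetric]
    by (intro exponent_ideal_Un exponent_ideal_generated assms)
qed

abbreviation erase :: "'x \<Rightarrow> ('x \<Rightarrow>\<^sub>0 nat) \<Rightarrow> ('x \<Rightarrow>\<^sub>0 nat)" where
  "erase x m \<equiv> Poly_Mapping.update x 0 m"

lemma erase_add: "erase x (a + b) = erase x a + erase x b"
  by (intro poly_mapping_eqI) (simp add: lookup_update lookup_add)

lemma erase_single: "erase x (Poly_Mapping.single x k) = 0"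
  by (intro poly_mapping_eqI) (simp add: lookup_update lookup_single when_def)

lemma erase_in_exponents: "m \<in> exponents X \<Longrightarrow> erase x m \<in> exponents (X - {x})"
  by (auto simp: exponents_def keys_update)

lemma erase_id: "m \<in> exponents (X - {x}) \<Longrightarrow> erase x m = m"
  by (intro poly_mapping_eqI) (auto simp: exponents_def lookup_update in_keys_iff)

lemma erase_plus_single: "erase x m + Poly_Mapping.single x (Poly_Mapping.lookup m x) = m"
  by (intro poly_mapping_eqI) (simp add: lookup_add lookup_update lookup_single when_def)

lemma supp_erase: "supp (erase x m) = supp m - {x}"
  by (simp add: keys_update)

lemma exponents_Diff_subset: "exponents (X - {x}) \<subseteq> exponents X"
  by (auto simp: exponents_def)

text \<open>Setting \<open>x = 1\<close> retracts the extension of an ideal of \<open>K[X - {x}]\<close> onto that ideal.\<close>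

lemma erase_extended:
  assumes "exponent_ideal (X - {x}) A" "m \<in> A + exponents X"
  shows "erase x m \<in> A"
proof -
  obtain a b where ab: "m = a + b" "a \<in> A" "b \<in> exponents X"
    using assms(2) by (auto elim: set_plus_elim)
  then have "erase x m = a + erase x b"
    using erase_id[OF exponent_idealD(1)[OF assms(1) ab(2)]] by (simp add: erase_add)
  then show ?thesis
    using exponent_idealD(2)[OF assms(1) ab(2) erase_in_exponents[OF ab(3)]] by simp
qed

text \<open>For \<open>I = x I\<^sub>1 + I\<^sub>2\<close> with \<open>I\<^sub>2 \<subseteq> I\<^sub>1\<close>, setting \<open>x = 1\<close> maps \<open>I\<^sup>k\<close> into \<open>I\<^sub>1\<^sup>k\<close>, while
  \<open>x\<^sup>k I\<^sub>1\<^sup>k \<subseteq> I\<^sup>k\<close>. Hence \<open>(I\<^sup>k : x\<^sup>k)\<close> is the extension of \<open>I\<^sub>1\<^sup>k\<close>.\<close>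

lemma split_colon_power:
  assumes A: "exponent_ideal (X - {x}) A" and B: "exponent_ideal (X - {x}) B" "B \<subseteq> A"
    and x: "x \<in> X" and m: "m \<in> exponents X"
  shows "m + Poly_Mapping.single x k \<in> sumset_power X (split_exponents x X A B) k \<longleftrightarrow>
         erase x m \<in> sumset_power (X - {x}) A k"
proof
  let ?M = "split_exponents x X A B"
  have base: "erase x w \<in> A" if w: "w \<in> ?M" for w
  proof -
    consider (left) "w \<in> {Poly_Mapping.single x 1} + (A + exponents X)"
      | (right) "w \<in> B + exponents X"
      using w unfolding split_exponents_def by blast
    then show ?thesis
    proof cases
      case left
      then obtain u where "w = Poly_Mapping.single x 1 + u" "u \<in> A + exponents X"
        by (metis set_plus_elim singletonD)
      then show ?thesis using erase_extended[OF A] by (simp add: erase_add erase_single)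
    next
      case right
      then show ?thesis using erase_extended[OF B(1)] B(2) by blast
    qed
  qed
  have "w \<in> sumset_power X ?M k \<Longrightarrow> erase x w \<in> sumset_power (X - {x}) A k" for w
  proof (induction k arbitrary: w)
    case 0
    then show ?case by (simp add: erase_in_exponents)
  next
    case (Suc k)
    then obtain a b where "w = a + b" "a \<in> sumset_power X ?M k" "b \<in> ?M"
      by (auto elim: set_plus_elim)
    then show ?case using Suc.IH base by (simp add: erase_add set_plus_intro)
  qed
  from this[of "m + Poly_Mapping.single x k"]
  show "m + Poly_Mapping.single x k \<in> sumset_power X ?M k \<Longrightarrow>
      erase x m \<in> sumset_power (X - {x}) A k"
    by (simp add: erase_add erase_single)
  have up: "u \<in> sumset_power (X - {x}) A k \<Longrightarrow> u + Poly_Mapping.single x k \<in> sumset_power X ?M k"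
    for u
  proof (induction k arbitrary: u)
    case 0
    then show ?case using exponents_Diff_subset[of X x] by auto
  next
    case (Suc k)
    then obtain a b where ab: "u = a + b" "a \<in> sumset_power (X - {x}) A k" "b \<in> A"
      by (auto elim: set_plus_elim)
    have "b \<in> A + exponents X" using set_plus_intro[OF ab(3) zero_in_exponents] by simp
    then have "Poly_Mapping.single x 1 + b \<in> ?M"
      unfolding split_exponents_def by (intro UnI1 set_plus_intro) simp_all
    then have "(a + Poly_Mapping.single x k) + (Poly_Mapping.single x 1 + b)
        \<in> sumset_power X ?M (Suc k)"
      unfolding sumset_power.simps by (rule set_plus_intro[OF Suc.IH[OF ab(2)]])
    moreover have "(a + Poly_Mapping.single x k) + (Poly_Mapping.single x 1 + b) =
        u + Poly_Mapping.single x (Suc k)"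
      unfolding ab(1) Suc_eq_plus1 single_add by (simp only: add_ac)
    ultimately show ?case by metis
  qed
  assume "erase x m \<in> sumset_power (X - {x}) A k"
  then have up_m: "erase x m + Poly_Mapping.single x k \<in> sumset_power X ?M k" by (rule up)
  have "A \<subseteq> exponents X" "B \<subseteq> exponents X"
    using A B exponents_Diff_subset[of X x] by (auto simp: exponent_ideal_def)
  then have "exponent_ideal X ?M" using x by (rule exponent_ideal_split)
  then have "exponent_ideal X (sumset_power X ?M k)" by (rule exponent_ideal_sumset_power)
  from exponent_idealD(2)[OF this up_m, of "Poly_Mapping.single x (Poly_Mapping.lookup m x)"]
  have "(erase x m + Poly_Mapping.single x k) + Poly_Mapping.single x (Poly_Mapping.lookup m x)
      \<in> sumset_power X ?M k" using x by simp
  then have "(erase x m + Poly_Mapping.single x (Poly_Mapping.lookup m x)) + Poly_Mapping.single x k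
      \<in> sumset_power X ?M k" by (simp only: add_ac)
  then show "m + Poly_Mapping.single x k \<in> sumset_power X ?M k"
    unfolding erase_plus_single .
qed


section \<open>Monomial ideals\<close>

definition monomial_span :: "('x \<Rightarrow>\<^sub>0 nat) set \<Rightarrow> ('x, 'k::field) mpoly set" where
  "monomial_span M = {p. Poly_Mapping.keys p \<subseteq> M}"

abbreviation monom :: "('x \<Rightarrow>\<^sub>0 nat) \<Rightarrow> ('x, 'k::field) mpoly" where
  "monom m \<equiv> Poly_Mapping.single m 1"

lemma carrier_poly_ring [simp]:
  "carrier (poly_ring X :: ('x, 'k::field) mpoly ring) = monomial_span (exponents X)"
  by (auto simp: poly_ring_def monomial_span_def exponents_def)

lemma poly_ring_ops [simp]:
  "\<zero>\<^bsub>poly_ring X\<^esub> = 0" "\<one>\<^bsub>poly_ring X\<^esub> = 1"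
  "p \<oplus>\<^bsub>poly_ring X\<^esub> q = p + q" "p \<otimes>\<^bsub>poly_ring X\<^esub> q = p * q"
  by (simp_all add: poly_ring_def)

lemma ring_poly_ring: "ring (poly_ring X :: ('x, 'k::field) mpoly ring)"
  using cring_poly_ring by (rule cring.axioms(1))

lemma zero_in_monomial_span [simp]: "0 \<in> monomial_span M"
  by (simp add: monomial_span_def)

lemma monomial_span_add: "p \<in> monomial_span M \<Longrightarrow> q \<in> monomial_span M \<Longrightarrow> p + q \<in> monomial_span M"
  unfolding monomial_span_def using Poly_Mapping.keys_add[of p q] by blast

lemma monomial_span_uminus: "p \<in> monomial_span M \<Longrightarrow> - p \<in> monomial_span M"
  by (simp add: monomial_span_def)

lemma monomial_span_minus: "p \<in> monomial_span M \<Longrightarrow> q \<in> monomial_span M \<Longrightarrow> p - q \<in> monomial_span M"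
  using monomial_span_add[of p M "- q"] monomial_span_uminus[of q M] by simp

lemma monomial_span_mult: "p \<in> monomial_span A \<Longrightarrow> q \<in> monomial_span B \<Longrightarrow> p * q \<in> monomial_span (A + B)"
  unfolding monomial_span_def using Poly_Mapping.keys_mult[of p q] by (blast intro: set_plus_intro)

lemma single_in_monomial_span: "m \<in> M \<Longrightarrow> Poly_Mapping.single m c \<in> monomial_span M"
  by (simp add: monomial_span_def)

lemma monom_in_monomial_span_iff [simp]: "monom m \<in> monomial_span M \<longleftrightarrow> m \<in> M"
  by (simp add: monomial_span_def)

lemma monom_neq_zero [simp]: "(monom m :: ('x, 'k::field) mpoly) \<noteq> 0"
  by (metis keys_single keys_zero insert_not_empty zero_neq_one)

lemma inj_monom: "inj (monom :: _ \<Rightarrow> ('x, 'k::field) mpoly)"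
  by (rule injI) (metis keys_single singleton_inject zero_neq_one)

lemma monomial_span_mono: "A \<subseteq> B \<Longrightarrow> monomial_span A \<subseteq> monomial_span B"
  by (auto simp: monomial_span_def)

lemma monomial_span_subset_iff: "monomial_span A \<subseteq> (monomial_span B :: ('x, 'k::field) mpoly set) \<longleftrightarrow> A \<subseteq> B"
proof
  assume *: "monomial_span A \<subseteq> (monomial_span B :: ('x, 'k) mpoly set)"
  show "A \<subseteq> B"
  proof
    fix m assume "m \<in> A"
    then have "monom m \<in> (monomial_span A :: ('x, 'k) mpoly set)" by simp
    then have "monom m \<in> (monomial_span B :: ('x, 'k) mpoly set)" using * by blast
    then show "m \<in> B" by simp
  qed
qed (rule monomial_span_mono)

lemma monomial_span_eq_iff: "monomial_span A = (monomial_span B :: ('x, 'k::field) mpoly set) \<longleftrightarrow> A = B"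
  using monomial_span_subset_iff[of A B, where 'k = 'k] monomial_span_subset_iff[of B A, where 'k = 'k]
  by blast

lemma monomial_span_empty: "monomial_span {} = {0}"
  by (auto simp: monomial_span_def)

lemma monomial_span_induct [consumes 1, case_names zero single add]:
  assumes "p \<in> monomial_span M" "P 0"
    and "\<And>m c. m \<in> M \<Longrightarrow> P (Poly_Mapping.single m c)"
    and "\<And>p q. P p \<Longrightarrow> P q \<Longrightarrow> P (p + q)"
  shows "P p"
  using assms(1)
proof (induction p rule: update_induct)
  case const
  then show ?case using assms(2) by simp
next
  case (update p m c)
  have eq: "Poly_Mapping.update m c p = p + Poly_Mapping.single m c"
    using update(1)
    by (intro poly_mapping_eqI) (auto simp: lookup_update lookup_add lookup_single in_keys_iff)
  have "Poly_Mapping.keys (Poly_Mapping.update m c p) = insert m (Poly_Mapping.keys p)"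
    using update(2) by (auto simp: keys_update)
  then have "p \<in> monomial_span M" "m \<in> M" using update(4) by (auto simp: monomial_span_def)
  then show ?case unfolding eq using assms(3,4) update(3) by blast
qed

lemma monomial_span_Un:
  assumes "p \<in> monomial_span (A \<union> B)"
  obtains a b where "a \<in> monomial_span A" "b \<in> monomial_span B" "p = a + b"
proof -
  have "\<exists>a \<in> monomial_span A. \<exists>b \<in> monomial_span B. p = a + b"
    using assms
  proof (induction rule: monomial_span_induct)
    case zero
    then show ?case by (metis add.left_neutral zero_in_monomial_span)
  next
    case (single m c)
    then show ?case
      by (metis Un_iff add.left_neutral add.right_neutral single_in_monomial_span zero_in_monomial_span)
  next
    case (add p q)
    then obtain a b a' b' where "a \<in> monomial_span A" "a' \<in> monomial_span A"
      "b \<in> monomial_span B" "b' \<in> monomial_span B" "p = a + b" "q = a' + b'" by blast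
    then have "a + a' \<in> monomial_span A" "b + b' \<in> monomial_span B" "p + q = (a + a') + (b + b')"
      by (simp_all add: monomial_span_add add_ac)
    then show ?case by blast
  qed
  then show ?thesis using that by blast
qed

lemma lookup_mult_monom: "Poly_Mapping.lookup (p * monom f) (m + f) = Poly_Mapping.lookup p m"
  for p :: "('x, 'k::field) mpoly"
proof -
  have "p \<in> monomial_span UNIV" by (simp add: monomial_span_def)
  then show ?thesis
    by (induction rule: monomial_span_induct)
      (simp_all add: mult_single lookup_single lookup_add distrib_right)
qed

lemma mult_monom_in_monomial_span_iff:
  "p * monom f \<in> monomial_span M \<longleftrightarrow> p \<in> monomial_span {m. m + f \<in> M}"
  for p :: "('x, 'k::field) mpoly"
proof
  assume *: "p * monom f \<in> monomial_span M"
  show "p \<in> monomial_span {m. m + f \<in> M}"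
    unfolding monomial_span_def
  proof safe
    fix m assume "m \<in> Poly_Mapping.keys p"
    then have "m + f \<in> Poly_Mapping.keys (p * monom f)" by (simp add: in_keys_iff lookup_mult_monom)
    then show "m + f \<in> M" using * by (auto simp: monomial_span_def)
  qed
next
  assume "p \<in> monomial_span {m. m + f \<in> M}"
  moreover have "(monom f :: ('x, 'k) mpoly) \<in> monomial_span {f}" by simp
  ultimately have "p * monom f \<in> monomial_span ({m. m + f \<in> M} + {f})" by (rule monomial_span_mult)
  then show "p * monom f \<in> monomial_span M"
    using monomial_span_mono[of "{m. m + f \<in> M} + {f}" M] by (auto simp: set_plus_def)
qed

lemma ideal_monomial_span:
  assumes M: "exponent_ideal X M"
  shows "ideal (monomial_span M :: ('x, 'k::field) mpoly set) (poly_ring X)"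
proof (rule idealI)
  let ?R = "poly_ring X :: ('x, 'k) mpoly ring"
  interpret R: ring ?R by (rule ring_poly_ring)
  show "ring ?R" by (rule ring_poly_ring)
  have sub: "monomial_span M \<subseteq> carrier ?R"
    using M monomial_span_mono by (auto simp: exponent_ideal_def)
  show "subgroup (monomial_span M) (add_monoid ?R)"
  proof (rule group.subgroupI[OF R.a_group])
    fix p :: "('x, 'k) mpoly" assume p: "p \<in> monomial_span M"
    have "inv\<^bsub>add_monoid ?R\<^esub> p = \<ominus>\<^bsub>?R\<^esub> p" by (simp add: a_inv_def)
    also have "\<dots> = - p"
      using p sub monomial_span_uminus[of p "exponents X"] by (intro R.minus_equality) auto
    finally show "inv\<^bsub>add_monoid ?R\<^esub> p \<in> monomial_span M"
      using p monomial_span_uminus by simp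
  next
    show "monomial_span M \<noteq> ({} :: ('x, 'k) mpoly set)" using zero_in_monomial_span by blast
  qed (use sub in \<open>simp_all add: monomial_span_add\<close>)
  have *: "p * q \<in> monomial_span M" if "p \<in> monomial_span M" "q \<in> carrier ?R" for p q :: "('x, 'k) mpoly"
    using monomial_span_mult[OF that(1), of q "exponents X"] that(2) M by (simp add: exponent_ideal_def)
  show "q \<otimes>\<^bsub>?R\<^esub> p \<in> monomial_span M" "p \<otimes>\<^bsub>?R\<^esub> q \<in> monomial_span M"
    if "p \<in> monomial_span M" "q \<in> carrier ?R" for p q
    using *[OF that] by (simp_all add: mult.commute)
qed

text \<open>The two cases of interest for \<open>G\<close> are a set of monomials and a monomial ideal of a polynomial
  ring in fewer variables that is extended to \<open>K[X]\<close>.\<close>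

lemma genideal_between:
  assumes "A \<subseteq> exponents X" "monom ` A \<subseteq> G" "G \<subseteq> monomial_span (A + exponents X)"
  shows "genideal (poly_ring X) G = (monomial_span (A + exponents X) :: ('x, 'k::field) mpoly set)"
proof
  let ?R = "poly_ring X :: ('x, 'k) mpoly ring"
  interpret R: ring ?R by (rule ring_poly_ring)
  have E: "exponent_ideal X (A + exponents X)" using assms(1) by (rule exponent_ideal_generated)
  show "genideal ?R G \<subseteq> monomial_span (A + exponents X)"
    using ideal_monomial_span[OF E] assms(3) by (rule R.genideal_minimal)
  have GR: "G \<subseteq> carrier ?R"
    using assms(3) E monomial_span_mono[of "A + exponents X" "exponents X"]
    by (auto simp: exponent_ideal_def)
  interpret I: ideal "genideal ?R G" ?R using GR by (rule R.genideal_ideal)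
  show "monomial_span (A + exponents X) \<subseteq> genideal ?R G"
  proof
    fix p :: "('x, 'k) mpoly" assume "p \<in> monomial_span (A + exponents X)"
    then show "p \<in> genideal ?R G"
    proof (induction rule: monomial_span_induct)
      case zero
      then show ?case using I.zero_closed by simp
    next
      case (single m c)
      then obtain a b where ab: "m = a + b" "a \<in> A" "b \<in> exponents X" by (rule set_plus_elim)
      have "monom a \<in> genideal ?R G" using ab(2) assms(2) R.genideal_self[OF GR] by blast
      moreover have "Poly_Mapping.single b c \<in> carrier ?R"
        using ab(3) by (simp add: single_in_monomial_span)
      ultimately have "monom a \<otimes>\<^bsub>?R\<^esub> Poly_Mapping.single b c \<in> genideal ?R G" by (rule I.I_r_closed)
      then show ?case by (simp add: mult_single ab(1))
    next
      case (add p q)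
      then show ?case using I.a_closed by simp
    qed
  qed
qed

lemma genideal_monomials:
  assumes "A \<subseteq> exponents X"
  shows "genideal (poly_ring X) (monom ` A) = (monomial_span (A + exponents X) :: ('x, 'k::field) mpoly set)"
proof (rule genideal_between[OF assms order_refl])
  show "monom ` A \<subseteq> (monomial_span (A + exponents X) :: ('x, 'k) mpoly set)"
    using set_zero_plus2[of "exponents X" A] by (auto simp: add.commute)
qed

lemma genideal_monomial_span:
  assumes "A \<subseteq> exponents X"
  shows "genideal (poly_ring X) (monomial_span A) = (monomial_span (A + exponents X) :: ('x, 'k::field) mpoly set)"
proof (rule genideal_between[OF assms])
  show "monomial_span A \<subseteq> (monomial_span (A + exponents X) :: ('x, 'k) mpoly set)"
    using set_zero_plus2[of "exponents X" A] by (simp add: monomial_span_mono add.commute)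
qed auto

lemma variable_times_monomial_span:
  "variable x <#\<^bsub>poly_ring X\<^esub> monomial_span A =
     (monomial_span ({Poly_Mapping.single x 1} + A) :: ('x, 'k::field) mpoly set)"
proof
  let ?e = "Poly_Mapping.single x 1 :: 'x \<Rightarrow>\<^sub>0 nat"
  show "variable x <#\<^bsub>poly_ring X\<^esub> monomial_span A \<subseteq> (monomial_span ({?e} + A) :: ('x, 'k) mpoly set)"
  proof
    fix p :: "('x, 'k) mpoly" assume "p \<in> variable x <#\<^bsub>poly_ring X\<^esub> monomial_span A"
    then obtain q where "q \<in> monomial_span A" "p = monom ?e * q"
      by (auto simp: l_coset_def variable_def)
    then show "p \<in> monomial_span ({?e} + A)"
      using monomial_span_mult[of "monom ?e" "{?e}" q A] by simp
  qed
  show "(monomial_span ({?e} + A) :: ('x, 'k) mpoly set) \<subseteq> variable x <#\<^bsub>poly_ring X\<^esub> monomial_span A"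
  proof
    fix p :: "('x, 'k) mpoly" assume "p \<in> monomial_span ({?e} + A)"
    then have "\<exists>q \<in> monomial_span A. p = variable x * q"
    proof (induction rule: monomial_span_induct)
      case zero
      show ?case by (intro bexI[of _ 0]) simp_all
    next
      case (single m c)
      then obtain a where "m = ?e + a" "a \<in> A" by (auto elim: set_plus_elim)
      then show ?case
        by (intro bexI[of _ "Poly_Mapping.single a c"])
          (simp_all add: variable_def mult_single single_in_monomial_span)
    next
      case (add p q)
      then obtain a b where "a \<in> monomial_span A" "b \<in> monomial_span A"
        "p = variable x * a" "q = variable x * b" by blast
      then show ?case by (intro bexI[of _ "a + b"]) (simp_all add: distrib_left monomial_span_add)
    qed
    then show "p \<in> variable x <#\<^bsub>poly_ring X\<^esub> monomial_span A" by (auto simp: l_coset_def)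
  qed
qed

lemma monomial_span_set_add:
  "monomial_span A <+>\<^bsub>poly_ring X\<^esub> monomial_span B = (monomial_span (A \<union> B) :: ('x, 'k::field) mpoly set)"
proof
  show "monomial_span A <+>\<^bsub>poly_ring X\<^esub> monomial_span B \<subseteq> (monomial_span (A \<union> B) :: ('x, 'k) mpoly set)"
  proof
    fix p :: "('x, 'k) mpoly"
    assume "p \<in> monomial_span A <+>\<^bsub>poly_ring X\<^esub> monomial_span B"
    then obtain a b where ab: "a \<in> monomial_span A" "b \<in> monomial_span B" "p = a + b"
      by (auto simp: set_add_def')
    then have "a \<in> monomial_span (A \<union> B)" "b \<in> monomial_span (A \<union> B)"
      using monomial_span_mono[of A "A \<union> B"] monomial_span_mono[of B "A \<union> B"] by blast+
    then show "p \<in> monomial_span (A \<union> B)" unfolding ab(3) by (rule monomial_span_add)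
  qed
  show "(monomial_span (A \<union> B) :: ('x, 'k) mpoly set) \<subseteq> monomial_span A <+>\<^bsub>poly_ring X\<^esub> monomial_span B"
  proof
    fix p :: "('x, 'k) mpoly" assume "p \<in> monomial_span (A \<union> B)"
    then obtain a b where "a \<in> monomial_span A" "b \<in> monomial_span B" "p = a + b"
      by (rule monomial_span_Un)
    then show "p \<in> monomial_span A <+>\<^bsub>poly_ring X\<^esub> monomial_span B"
      by (auto simp: set_add_def')
  qed
qed

lemma monomial_span_ideal_prod:
  "ideal_prod (poly_ring X) (monomial_span A) (monomial_span B) =
     (monomial_span (A + B) :: ('x, 'k::field) mpoly set)"
proof
  let ?P = "ideal_prod (poly_ring X) (monomial_span A) (monomial_span B) :: ('x, 'k) mpoly set"
  show "?P \<subseteq> monomial_span (A + B)"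
  proof
    fix p assume "p \<in> ?P"
    then show "p \<in> monomial_span (A + B)"
      by (induction rule: ideal_prod.induct) (simp_all add: monomial_span_mult monomial_span_add)
  qed
  show "monomial_span (A + B) \<subseteq> ?P"
  proof
    fix p :: "('x, 'k) mpoly" assume "p \<in> monomial_span (A + B)"
    then show "p \<in> ?P"
    proof (induction rule: monomial_span_induct)
      case zero
      then show ?case
        using ideal_prod.prod[of 0 "monomial_span A" 0 "monomial_span B" "poly_ring X"] by simp
    next
      case (single m c)
      then obtain a b where "m = a + b" "a \<in> A" "b \<in> B" by (rule set_plus_elim)
      then show ?case
        using ideal_prod.prod[of "Poly_Mapping.single a c" "monomial_span A" "monom b" "monomial_span B" "poly_ring X"]
        by (simp add: mult_single single_in_monomial_span)
    next
      case (add p q)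
      then show ?case
        using ideal_prod.sum[of p "poly_ring X" "monomial_span A" "monomial_span B" q] by simp
    qed
  qed
qed

lemma ideal_power_monomial_span:
  "ideal_power X (monomial_span M) k = (monomial_span (sumset_power X M k) :: ('x, 'k::field) mpoly set)"
proof (induction k)
  case 0
  show ?case by (simp add: ideals_set_def)
next
  case (Suc k)
  have "ideal_power X (monomial_span M) (Suc k) =
      ideal_prod (poly_ring X) (ideal_power X (monomial_span M) k) (monomial_span M :: ('x, 'k) mpoly set)"
    by (simp add: ideals_set_def)
  then show ?case by (simp only: Suc monomial_span_ideal_prod sumset_power.simps)
qed

text \<open>A set of monomials of a monomial ideal generates it iff it contains the minimal ones, so that the
  minimal monomials form the only irredundant generating set.\<close>

lemma min_gens_monomial_span:
  assumes M: "exponent_ideal X M"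
  shows "min_gens X (monomial_span M :: ('x, 'k::field) mpoly set) = monom ` minimal_exponents M"
proof -
  let ?gen = "\<lambda>B. genideal (poly_ring X) (monom ` B) :: ('x, 'k) mpoly set"
  let ?J = "monomial_span M :: ('x, 'k) mpoly set"
  have min_X: "minimal_exponents M \<subseteq> exponents X"
    using exponent_idealD(1)[OF M] by (auto simp: minimal_exponents_def)
  have gen_iff: "?gen B = ?J \<longleftrightarrow> B + exponents X = M" if "B \<subseteq> exponents X" for B
    using that by (simp add: genideal_monomials monomial_span_eq_iff)
  have needed: "minimal_exponents M \<subseteq> B" if B: "B + exponents X = M" for B
  proof
    fix m assume m: "m \<in> minimal_exponents M"
    then have "m \<in> B + exponents X" using B by (simp add: minimal_exponents_def)
    then obtain a b where ab: "m = a + b" "a \<in> B" "b \<in> exponents X" by (rule set_plus_elim)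
    then have "a \<in> M" using B set_plus_intro[OF ab(2) zero_in_exponents] by auto
    then have "b = 0" using m ab(1) by (simp add: minimal_exponents_def)
    then show "m \<in> B" using ab by simp
  qed
  have gens: "?gen (minimal_exponents M) = ?J"
    using gen_iff[OF min_X] generated_by_minimal_exponents[OF M] by simp
  have mono_image: "(monomials X :: ('x, 'k) mpoly set) = monom ` exponents X"
    by (auto simp: monomials_def exponents_def)
  show ?thesis
    unfolding min_gens_def
  proof (rule the_equality)
    show "monom ` minimal_exponents M \<subseteq> (monomials X :: ('x, 'k) mpoly set) \<and>
        ?gen (minimal_exponents M) = ?J \<and>
        (\<forall>H. H \<subset> monom ` minimal_exponents M \<longrightarrow> genideal (poly_ring X) H \<noteq> ?J)"
    proof (intro conjI allI impI)
      show "monom ` minimal_exponents M \<subseteq> (monomials X :: ('x, 'k) mpoly set)"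
        unfolding mono_image using min_X by (rule image_mono)
      show "?gen (minimal_exponents M) = ?J" by (rule gens)
    next
      fix H :: "('x, 'k) mpoly set" assume H: "H \<subset> monom ` minimal_exponents M"
      then obtain B where B: "B \<subseteq> minimal_exponents M" "H = monom ` B"
        by (meson psubset_imp_subset subset_imageE)
      then have "\<not> minimal_exponents M \<subseteq> B" using H by auto
      then show "genideal (poly_ring X) H \<noteq> ?J"
        using needed[of B] gen_iff[of B] B min_X by auto
    qed
  next
    fix G :: "('x, 'k) mpoly set"
    assume G: "G \<subseteq> monomials X \<and> genideal (poly_ring X) G = ?J \<and>
        (\<forall>H. H \<subset> G \<longrightarrow> genideal (poly_ring X) H \<noteq> ?J)"
    then obtain B where B: "B \<subseteq> exponents X" "G = monom ` B"
      unfolding mono_image by (meson subset_imageE)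
    then have "minimal_exponents M \<subseteq> B" using G gen_iff[of B] needed[of B] by simp
    then have "monom ` minimal_exponents M \<subseteq> G" using B by blast
    then show "G = monom ` minimal_exponents M" using G gens by blast
  qed
qed

lemma monom_in_hom_component_iff:
  "(monom m :: ('x, 'k::field) mpoly) \<in> hom_component X d \<longleftrightarrow> m \<in> exponents X \<and> total_degree m = d"
  by (auto simp: hom_component_def degree_in_def)

lemma min_gens_subset_hom_component_iff:
  assumes M: "exponent_ideal X M"
  shows "min_gens X (monomial_span M :: ('x, 'k::field) mpoly set) \<subseteq> hom_component X d \<longleftrightarrow>
    minimal_exponents M \<subseteq> {m. total_degree m = d}"
  using exponent_idealD(1)[OF M]
  by (auto simp: min_gens_monomial_span[OF M] monom_in_hom_component_iff minimal_exponents_def)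


section \<open>Prime ideals generated by variables\<close>

lemma colon_monomial_span:
  "colon (poly_ring X) (monomial_span N) (monom f) =
     (monomial_span {m \<in> exponents X. m + f \<in> N} :: ('x, 'k::field) mpoly set)"
proof -
  have "p \<in> colon (poly_ring X) (monomial_span N) (monom f) \<longleftrightarrow>
      p \<in> monomial_span {m \<in> exponents X. m + f \<in> N}" for p :: "('x, 'k) mpoly"
  proof -
    have "p \<in> colon (poly_ring X) (monomial_span N) (monom f) \<longleftrightarrow>
        p \<in> monomial_span (exponents X) \<and> p \<in> monomial_span {m. m + f \<in> N}"
      by (simp add: colon_def mult_monom_in_monomial_span_iff)
    also have "\<dots> \<longleftrightarrow> p \<in> monomial_span {m \<in> exponents X. m + f \<in> N}"
      unfolding monomial_span_def by blast
    finally show ?thesis .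
  qed
  then show ?thesis by blast
qed

text \<open>Modulo the ideal generated by the variables in \<open>V\<close>, every polynomial is represented by one that
  does not involve \<open>V\<close>, and such representatives multiply without zero divisors. The variables are
  linearly ordered because the absence of zero divisors comes from comparing leading terms.\<close>

lemma primeideal_variables:
  fixes X V :: "'x::linorder set"
  shows "primeideal (monomial_span {m \<in> exponents X. supp m \<inter> V \<noteq> {}} :: ('x, 'k::field) mpoly set)
           (poly_ring X)"
proof (rule primeidealI)
  let ?R = "poly_ring X :: ('x, 'k) mpoly ring"
  let ?A = "{m \<in> exponents X. supp m \<inter> V \<noteq> {}}" and ?B = "{m \<in> exponents X. supp m \<inter> V = {}}"
  let ?P = "monomial_span ?A :: ('x, 'k) mpoly set"
  have "?A + exponents X \<subseteq> ?A"
  proof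
    fix m assume "m \<in> ?A + exponents X"
    then obtain a b where "m = a + b" "a \<in> ?A" "b \<in> exponents X" by (rule set_plus_elim)
    then show "m \<in> ?A" by (simp add: supp_add) blast
  qed
  moreover have "?A \<subseteq> ?A + exponents X"
    using set_zero_plus2[OF zero_in_exponents, of ?A X] by (simp add: add.commute)
  ultimately have A: "exponent_ideal X ?A"
    unfolding exponent_ideal_def by (intro conjI subset_antisym) simp_all
  show "ideal ?P ?R" using A by (rule ideal_monomial_span)
  show "cring ?R" by (rule cring_poly_ring)
  show "carrier ?R \<noteq> ?P"
  proof -
    have "0 \<in> exponents X" "0 \<notin> ?A" by simp_all
    then have "exponents X \<noteq> ?A" by blast
    then show ?thesis by (simp only: carrier_poly_ring monomial_span_eq_iff not_False_eq_True)
  qed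
  fix p q :: "('x, 'k) mpoly"
  assume pq: "p \<in> carrier ?R" "q \<in> carrier ?R" "p \<otimes>\<^bsub>?R\<^esub> q \<in> ?P"
  have AB: "?A \<union> ?B = exponents X" by blast
  have "p \<in> monomial_span (?A \<union> ?B)" "q \<in> monomial_span (?A \<union> ?B)"
    using pq(1,2) unfolding carrier_poly_ring AB .
  then obtain p1 p0 q1 q0 where p: "p1 \<in> ?P" "p0 \<in> monomial_span ?B" "p = p1 + p0"
    and q: "q1 \<in> ?P" "q0 \<in> monomial_span ?B" "q = q1 + q0"
    by (meson monomial_span_Un)
  interpret P: ideal ?P ?R using A by (rule ideal_monomial_span)
  have "p0 \<in> carrier ?R" using p(2) monomial_span_mono[of ?B "exponents X"] by auto
  then have "p1 * q \<in> ?P" "p0 * q1 \<in> ?P"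
    using P.I_r_closed[OF p(1) pq(2)] P.I_l_closed[OF q(1), of p0] by simp_all
  moreover have "p0 * q0 = p * q - (p1 * q + p0 * q1)" by (simp add: p q algebra_simps)
  ultimately have "p0 * q0 \<in> ?P"
    using pq(3) by (simp add: monomial_span_add monomial_span_minus)
  moreover have "p0 * q0 \<in> monomial_span ?B"
  proof -
    have "?B + ?B \<subseteq> ?B"
    proof
      fix m assume "m \<in> ?B + ?B"
      then obtain a b where "m = a + b" "a \<in> ?B" "b \<in> ?B" by (rule set_plus_elim)
      then show "m \<in> ?B" by (simp add: supp_add Int_Un_distrib2)
    qed
    then show ?thesis using monomial_span_mult[OF p(2) q(2)] monomial_span_mono by blast
  qed
  ultimately have "Poly_Mapping.keys (p0 * q0) = {}" unfolding monomial_span_def by blast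
  then have "p0 * q0 = 0" by simp
  then have "p0 = 0 \<or> q0 = 0" by simp
  then show "p \<in> ?P \<or> q \<in> ?P" using p q by auto
qed

text \<open>A monomial is a product of variables, and a prime ideal containing a product contains a factor.\<close>

lemma prime_contains_variable:
  assumes P: "primeideal P (poly_ring X)" and m: "m \<in> exponents X"
  shows "(monom m :: ('x, 'k::field) mpoly) \<in> P \<Longrightarrow> \<exists>x \<in> X. monom (Poly_Mapping.single x 1) \<in> P"
  using m
proof (induction "total_degree m" arbitrary: m rule: less_induct)
  case less
  let ?R = "poly_ring X :: ('x, 'k) mpoly ring"
  interpret P: primeideal P ?R by (rule P)
  have "m \<noteq> 0"
  proof
    assume "m = 0"
    then have "\<one>\<^bsub>?R\<^esub> \<in> P" using less.prems(1) by simp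
    then show False using P.one_imp_carrier P.I_notcarr by simp
  qed
  then obtain x where x: "x \<in> supp m" by (metis all_not_in_conv keys_eq_empty)
  then have xX: "x \<in> X" using less.prems(2) by (auto simp: exponents_def)
  obtain w where w: "m = w + Poly_Mapping.single x 1" using split_off_variable[OF x] .
  have wX: "w \<in> exponents X" using less.prems(2) w by simp
  have "monom w \<otimes>\<^bsub>?R\<^esub> monom (Poly_Mapping.single x 1) \<in> P"
    using less.prems(1) by (simp add: mult_single w)
  then have "monom w \<in> P \<or> monom (Poly_Mapping.single x 1) \<in> P"
    using wX xX by (intro P.I_prime) simp_all
  moreover have "total_degree w < total_degree m" by (simp add: w degree_in_add degree_in_single)
  ultimately show ?case using less.hyps wX xX by blast
qed

text \<open>The annihilator of the residue class of \<open>f\<close> in \<open>R / I\<close> is \<open>(I : f)\<close>.\<close>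

lemma prime_colon_in_associated_primes:
  assumes I: "ideal I R" and f: "f \<in> carrier R" and prime: "primeideal (colon R I f) R"
  shows "colon R I f \<in> associated_primes R I"
proof -
  interpret I: ideal I R by (rule I)
  have "(I +>\<^bsub>R\<^esub> g) \<otimes>\<^bsub>R Quot I\<^esub> (I +>\<^bsub>R\<^esub> f) = \<zero>\<^bsub>R Quot I\<^esub> \<longleftrightarrow> g \<otimes>\<^bsub>R\<^esub> f \<in> I" if g: "g \<in> carrier R" for g
  proof -
    have "(I +>\<^bsub>R\<^esub> g) \<otimes>\<^bsub>R Quot I\<^esub> (I +>\<^bsub>R\<^esub> f) = I +>\<^bsub>R\<^esub> (g \<otimes>\<^bsub>R\<^esub> f)"
      using I.rcoset_mult_add[OF g f] by (simp add: FactRing_def)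
    moreover have "\<zero>\<^bsub>R Quot I\<^esub> = I" by (simp add: FactRing_def)
    moreover have "g \<otimes>\<^bsub>R\<^esub> f \<in> carrier R" using g f by (rule I.m_closed)
    ultimately show ?thesis
      using I.rcos_const_imp_mem[of "g \<otimes>\<^bsub>R\<^esub> f"] I.a_rcos_zero[OF I, of "g \<otimes>\<^bsub>R\<^esub> f"]
      by metis
  qed
  then have "colon R I f =
      {g \<in> carrier R. (I +>\<^bsub>R\<^esub> g) \<otimes>\<^bsub>R Quot I\<^esub> (I +>\<^bsub>R\<^esub> f) = \<zero>\<^bsub>R Quot I\<^esub>}"
    by (auto simp: colon_def)
  moreover have "I +>\<^bsub>R\<^esub> f \<in> carrier (R Quot I)"
    using f by (auto simp: FactRing_def A_RCOSETS_def')
  ultimately show ?thesis using prime by (auto simp: associated_primes_def)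
qed


section \<open>Vertex splittable ideals\<close>

lemma variable_colon_split:
  assumes A: "exponent_ideal (X - {x}) A" and B: "exponent_ideal (X - {x}) B" "B \<subseteq> A"
    and x: "x \<in> X"
    and fV: "variable_colon (X - {x}) (sumset_power (X - {x}) A k) f V"
  shows "variable_colon X (sumset_power X (split_exponents x X A B) k) (f + Poly_Mapping.single x k) V"
proof -
  have f: "f \<in> exponents (X - {x})" and V: "V \<subseteq> X - {x}"
    and colon: "\<And>m. m \<in> exponents (X - {x}) \<Longrightarrow>
      m + f \<in> sumset_power (X - {x}) A k \<longleftrightarrow> supp m \<inter> V \<noteq> {}"
    using fV by (auto simp: variable_colon_def)
  have fX: "f \<in> exponents X" using exponents_Diff_subset f by (rule subsetD)
  have "m + (f + Poly_Mapping.single x k) \<in> sumset_power X (split_exponents x X A B) k \<longleftrightarrow>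
      supp m \<inter> V \<noteq> {}" if m: "m \<in> exponents X" for m
  proof -
    have "m + (f + Poly_Mapping.single x k) \<in> sumset_power X (split_exponents x X A B) k \<longleftrightarrow>
        erase x (m + f) \<in> sumset_power (X - {x}) A k"
      unfolding add.assoc[symmetric] by (rule split_colon_power[OF A B x]) (simp add: m fX)
    also have "erase x (m + f) = erase x m + f" by (simp add: erase_add erase_id[OF f])
    also have "\<dots> \<in> sumset_power (X - {x}) A k \<longleftrightarrow> supp (erase x m) \<inter> V \<noteq> {}"
      by (rule colon[OF erase_in_exponents[OF m]])
    also have "supp (erase x m) \<inter> V = supp m \<inter> V" using V by (auto simp: supp_erase)
    finally show ?thesis .
  qed
  then show ?thesis using fX x V by (auto simp: variable_colon_def)
qed

text \<open>Minimality of \<open>a\<close> among the exponents over \<open>X - {x}\<close> persists in the extension to \<open>K[X]\<close>, because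
  a divisor of a monomial without \<open>x\<close> is itself free of \<open>x\<close>.\<close>

lemma minimal_exponents_shift:
  assumes A: "exponent_ideal (X - {x}) A" and a: "a \<in> minimal_exponents A"
  shows "Poly_Mapping.single x 1 + a \<in>
           minimal_exponents ({Poly_Mapping.single x 1} + (A + exponents X))"
proof -
  let ?e = "Poly_Mapping.single x 1 :: _ \<Rightarrow>\<^sub>0 nat"
  have aA: "a \<in> A" using a by (simp add: minimal_exponents_def)
  then have aX: "a \<in> exponents (X - {x})" using exponent_idealD(1)[OF A] by blast
  have "a \<in> A + exponents X" using set_plus_intro[OF aA zero_in_exponents] by simp
  then have "?e + a \<in> {?e} + (A + exponents X)" by (intro set_plus_intro) simp_all
  moreover have "b = 0" if c: "c \<in> {?e} + (A + exponents X)" "?e + a = c + b" for c b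
  proof -
    obtain u where u: "c = ?e + u" "u \<in> A + exponents X"
      using c(1) by (metis set_plus_elim singletonD)
    have "?e + a = ?e + (u + b)" using c(2) u(1) by (simp only: add.assoc)
    then have ab: "a = u + b" by (rule add_left_imp_eq)
    have "a = erase x u + erase x b"
      using arg_cong[OF ab, of "erase x"] erase_id[OF aX] by (simp add: erase_add)
    then have "erase x b = 0"
      using a erase_extended[OF A u(2)] by (simp add: minimal_exponents_def)
    moreover have "b \<in> exponents (X - {x})" using aX ab by simp
    ultimately show "b = 0" using erase_id by metis
  qed
  ultimately show ?thesis by (simp add: minimal_exponents_def del: single_one)
qed

text \<open>The induction behind the theorem. If \<open>I = x I\<^sub>1 + I\<^sub>2\<close> is generated in degree \<open>d\<close>, then the
  condition on the minimal generators forces \<open>I\<^sub>1\<close> to be generated in degree \<open>d - 1\<close>. Unless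
  \<open>d = 1\<close>, the ideal \<open>I\<^sub>1\<close> is proper, and multiplication by \<open>x\<^sup>k\<close> carries a monomial \<open>f\<close> with
  \<open>(I\<^sub>1\<^sup>k : f)\<close> generated by variables over to one for \<open>I\<^sup>k\<close>.\<close>

lemma vertex_splittable_variable_colon:
  fixes I :: "('x, 'k::field) mpoly set"
  assumes "vertex_splittable X I"
  shows "\<exists>M. exponent_ideal X M \<and> I = monomial_span M \<and>
    (\<forall>d k. M \<noteq> {} \<longrightarrow> 0 \<notin> M \<longrightarrow> minimal_exponents M \<subseteq> {m. total_degree m = d} \<longrightarrow> k \<ge> 1 \<longrightarrow>
       (\<exists>f V. variable_colon X (sumset_power X M k) f V \<and> total_degree f + 1 = d * k))"
  using assms
proof induction
  case (principal v X)
  then obtain m where m: "v = monom m" "m \<in> exponents X"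
    by (auto simp: monomials_def exponents_def)
  let ?M = "{m} + exponents X"
  have M: "exponent_ideal X ?M" using m by (intro exponent_ideal_generated) simp
  have "genideal (poly_ring X) {v} = monomial_span ?M"
    using genideal_monomials[of "{m}" X, where 'k = 'k] m by simp
  moreover have "\<exists>f V. variable_colon X (sumset_power X ?M k) f V \<and> total_degree f + 1 = d * k"
    if "0 \<notin> ?M" "minimal_exponents ?M \<subseteq> {m. total_degree m = d}" "k \<ge> 1" for d k
  proof -
    have m_M: "m \<in> ?M" using set_plus_intro[of m "{m}" 0 "exponents X"] by simp
    have "b = 0" if ab: "a \<in> ?M" "m = a + b" for a b
    proof -
      obtain c where "a = m + c" using ab(1) by (metis set_plus_elim singletonD)
      then have "m + 0 = m + (c + b)" using ab(2) by (metis add.assoc add.right_neutral)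
      then have "0 = c + b" by (rule add_left_imp_eq)
      then have "supp c \<union> supp b = {}" by (metis keys_zero supp_add)
      then show "b = 0" by simp
    qed
    then have "m \<in> minimal_exponents ?M" using m_M unfolding minimal_exponents_def by blast
    then have "total_degree m = d" using that(2) by blast
    moreover have "m \<noteq> 0" using m_M that(1) by metis
    ultimately show ?thesis using variable_colon_principal[OF m(2) _ that(3)] by blast
  qed
  ultimately show ?case using M by blast
next
  case (zero X)
  have "exponent_ideal X {}" by (simp add: exponent_ideal_def)
  moreover have "{\<zero>\<^bsub>poly_ring X\<^esub>} = (monomial_span {} :: ('x, 'k) mpoly set)"
    by (simp add: monomial_span_empty)
  ultimately show ?case by blast
next
  case (unit X)
  have "0 \<in> exponents X" by simp
  then show ?case using exponent_ideal_exponents[of X] carrier_poly_ring[of X, where 'k = 'k] by blast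
next
  case (split x X I1 I2 J1 J2 I)
  obtain A where A: "exponent_ideal (X - {x}) A" "I1 = monomial_span A"
    and IH: "\<And>d k. A \<noteq> {} \<Longrightarrow> 0 \<notin> A \<Longrightarrow> minimal_exponents A \<subseteq> {m. total_degree m = d} \<Longrightarrow> k \<ge> 1 \<Longrightarrow>
      \<exists>f V. variable_colon (X - {x}) (sumset_power (X - {x}) A k) f V \<and> total_degree f + 1 = d * k"
    using split.IH(1) by blast
  obtain B where B: "exponent_ideal (X - {x}) B" "I2 = monomial_span B"
    using split.IH(2) by blast
  have BA: "B \<subseteq> A" using \<open>I2 \<subseteq> I1\<close> A B by (simp add: monomial_span_subset_iff)
  have AX: "A \<subseteq> exponents X" and BX: "B \<subseteq> exponents X"
    using A(1) B(1) exponents_Diff_subset[of X x] by (auto simp: exponent_ideal_def)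
  let ?e = "Poly_Mapping.single x 1 :: 'x \<Rightarrow>\<^sub>0 nat"
  let ?L = "{?e} + (A + exponents X)" and ?M = "split_exponents x X A B"
  have M: "exponent_ideal X ?M" using AX BX split.hyps(1) by (rule exponent_ideal_split)
  have L: "exponent_ideal X ?L"
    using exponent_ideal_generated[of "{?e} + A" X] set_plus_mono2[of "{?e}" "exponents X" A "exponents X"]
      AX split.hyps(1) by (simp add: add.assoc)
  have xJ1: "variable x <#\<^bsub>poly_ring X\<^esub> J1 = monomial_span ?L"
    unfolding \<open>J1 = _\<close> A(2) genideal_monomial_span[OF AX] by (rule variable_times_monomial_span)
  have J2: "J2 = monomial_span (B + exponents X)"
    unfolding \<open>J2 = _\<close> B(2) by (rule genideal_monomial_span[OF BX])
  have I: "I = monomial_span ?M"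
    unfolding \<open>I = _\<close> xJ1 unfolding J2 split_exponents_def by (rule monomial_span_set_add)
  \<comment> \<open>A minimal generator of \<open>x I\<^sub>1\<close> could be a proper multiple of one of \<open>I\<^sub>2\<close>; the condition on the
    minimal generators in the definition of vertex splittable ideals excludes this.\<close>
  have "minimal_exponents ?L \<subseteq> minimal_exponents ?M"
  proof -
    have "min_gens X (monomial_span ?L) \<subseteq> min_gens X (monomial_span ?M :: ('x, 'k) mpoly set)"
      using \<open>min_gens X I = _\<close> unfolding xJ1 I by (metis Un_upper1)
    then show ?thesis
      unfolding min_gens_monomial_span[OF L] min_gens_monomial_span[OF M]
        inj_image_subset_iff[OF inj_monom] .
  qed
  then have shift: "?e + a \<in> minimal_exponents ?M" if "a \<in> minimal_exponents A" for a
    using minimal_exponents_shift[OF A(1) that] by blast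
  have "\<exists>f V. variable_colon X (sumset_power X ?M k) f V \<and> total_degree f + 1 = d * k"
    if asm: "?M \<noteq> {}" "0 \<notin> ?M" "minimal_exponents ?M \<subseteq> {m. total_degree m = d}" "k \<ge> 1" for d k
  proof -
    have degree: "1 + total_degree a = d" if "a \<in> minimal_exponents A" for a
      using shift[OF that] asm(3)
      by (auto simp: degree_in_add degree_in_single simp del: single_one)
    have "A \<noteq> {}" using asm(1) BA by (auto simp: split_exponents_def)
    then obtain a where a: "a \<in> minimal_exponents A" using minimal_exponent_below[OF A(1)] by blast
    show ?thesis
    proof (cases "0 \<in> A")
      case True
      \<comment> \<open>Here \<open>I\<^sub>1\<close> is the unit ideal, so \<open>x\<close> is a minimal generator of \<open>I\<close>.\<close>
      then have "0 \<in> minimal_exponents A"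
        by (simp add: minimal_exponents_def) (metis Un_empty keys_eq_empty keys_zero supp_add)
      then have "d = 1" using degree by force
      then show ?thesis using variable_colon_linear[OF M asm(1) _ asm(4)] asm(3) by simp
    next
      case False
      have "minimal_exponents A \<subseteq> {m. total_degree m = d - 1}" using degree by force
      then obtain f V where fV: "variable_colon (X - {x}) (sumset_power (X - {x}) A k) f V"
        "total_degree f + 1 = (d - 1) * k"
        using IH[OF \<open>A \<noteq> {}\<close> False _ asm(4)] by blast
      have "d * k = (d - 1) * k + k" using degree[OF a] by (cases d) simp_all
      then have "total_degree (f + Poly_Mapping.single x k) + 1 = d * k"
        using fV(2) by (simp add: degree_in_add degree_in_single)
      then show ?thesis using variable_colon_split[OF A(1) B(1) BA split.hyps(1) fV(1)] by blast
    qed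
  qed
  then show ?case using M I by blast
qed


section \<open>Initial degree and v-number\<close>

lemma initial_degree_monomial_span:
  assumes M: "exponent_ideal X M" "M \<noteq> {}"
    and d: "minimal_exponents M \<subseteq> {m. total_degree m = d}"
  shows "initial_degree X (monomial_span M :: ('x, 'k::field) mpoly set) = d"
  unfolding initial_degree_def
proof (rule Least_equality)
  obtain a where a: "a \<in> minimal_exponents M" using M minimal_exponent_below by blast
  then have "a \<in> M" "a \<in> exponents X" "total_degree a = d"
    using d exponent_idealD(1)[OF M(1)] by (auto simp: minimal_exponents_def)
  then show "\<exists>f \<in> hom_component X d. f \<in> monomial_span M \<and> f \<noteq> (\<zero>\<^bsub>poly_ring X\<^esub> :: ('x, 'k) mpoly)"
    by (intro bexI[of _ "monom a"]) (simp_all add: monom_in_hom_component_iff)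
next
  fix e assume "\<exists>f \<in> hom_component X e. f \<in> monomial_span M \<and> f \<noteq> (\<zero>\<^bsub>poly_ring X\<^esub> :: ('x, 'k) mpoly)"
  then obtain f :: "('x, 'k) mpoly" where f: "f \<in> hom_component X e" "f \<in> monomial_span M" "f \<noteq> 0"
    by auto
  then obtain m where m: "m \<in> Poly_Mapping.keys f" by (metis all_not_in_conv keys_eq_empty)
  then have "m \<in> M" "total_degree m = e"
    using f by (auto simp: monomial_span_def hom_component_def degree_in_def)
  then show "d \<le> e" using generated_degree_le[OF M(1) d] by blast
qed

text \<open>A prime colon ideal \<open>(J : f)\<close> of a nonzero monomial ideal \<open>J\<close> contains a monomial, hence a variable
  \<open>x\<close>; then \<open>x f\<close> is a nonzero element of \<open>J\<close>.\<close>

lemma prime_colon_degree: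
  fixes f :: "('x, 'k::field) mpoly"
  assumes N: "exponent_ideal X N" "N \<noteq> {}" and c: "\<And>m. m \<in> N \<Longrightarrow> c \<le> total_degree m"
    and f: "f \<in> hom_component X e"
    and prime: "primeideal (colon (poly_ring X) (monomial_span N) f) (poly_ring X)"
  shows "c \<le> e + 1"
proof -
  let ?R = "poly_ring X :: ('x, 'k) mpoly ring"
  let ?P = "colon ?R (monomial_span N) f"
  interpret P: primeideal ?P ?R by (rule prime)
  interpret J: ideal "monomial_span N" ?R using N(1) by (rule ideal_monomial_span)
  have fR: "f \<in> carrier ?R" using f by (simp add: hom_component_def)
  have "f \<noteq> 0"
  proof
    assume "f = 0"
    then have "?P = carrier ?R" by (auto simp: colon_def)
    then show False using P.I_notcarr by simp
  qed
  then obtain u where u: "u \<in> Poly_Mapping.keys f" by (metis all_not_in_conv keys_eq_empty)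
  then have u_deg: "total_degree u = e" using f by (auto simp: hom_component_def degree_in_def)
  obtain n where n: "n \<in> N" using N(2) by blast
  then have nX: "n \<in> exponents X" using exponent_idealD(1)[OF N(1)] by blast
  have "monom n \<otimes>\<^bsub>?R\<^esub> f \<in> monomial_span N"
    using n fR by (intro J.I_r_closed) simp_all
  then have "monom n \<in> ?P" using nX by (simp add: colon_def)
  then obtain x where "monom (Poly_Mapping.single x 1) \<in> ?P"
    using prime_contains_variable[OF prime nX] by blast
  then have "f * monom (Poly_Mapping.single x 1) \<in> monomial_span N"
    by (simp add: colon_def mult.commute)
  then have "u + Poly_Mapping.single x 1 \<in> N"
    using u unfolding mult_monom_in_monomial_span_iff by (auto simp: monomial_span_def)
  then have "c \<le> total_degree (u + Poly_Mapping.single x 1)" by (rule c)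
  then show ?thesis by (simp add: degree_in_add degree_in_single u_deg)
qed

lemma v_number_monomial_span:
  fixes X :: "'x::linorder set"
  assumes N: "exponent_ideal X N" "N \<noteq> {}"
    and bound: "\<And>m. m \<in> N \<Longrightarrow> total_degree f + 1 \<le> total_degree m"
    and fV: "variable_colon X N f V"
  shows "v_number X (monomial_span N :: ('x, 'k::field) mpoly set) = total_degree f"
  unfolding v_number_def
proof (rule Least_equality)
  let ?R = "poly_ring X :: ('x, 'k) mpoly ring"
  let ?J = "monomial_span N :: ('x, 'k) mpoly set"
  have fX: "f \<in> exponents X" using fV by (simp add: variable_colon_def)
  have "{m \<in> exponents X. m + f \<in> N} = {m \<in> exponents X. supp m \<inter> V \<noteq> {}}"
    using fV by (auto simp: variable_colon_def)
  then have "primeideal (colon ?R ?J (monom f)) ?R"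
    by (simp only: colon_monomial_span primeideal_variables)
  then have "colon ?R ?J (monom f) \<in> associated_primes ?R ?J"
    using fX by (intro prime_colon_in_associated_primes ideal_monomial_span N(1)) simp_all
  then show "\<exists>g \<in> hom_component X (total_degree f). \<exists>P \<in> associated_primes ?R ?J. colon ?R ?J g = P"
    using fX by (intro bexI[of _ "monom f"]) (simp_all add: monom_in_hom_component_iff)
next
  fix e
  assume "\<exists>g \<in> hom_component X e. \<exists>P \<in> associated_primes (poly_ring X) (monomial_span N :: ('x, 'k) mpoly set).
    colon (poly_ring X) (monomial_span N) g = P"
  then obtain g :: "('x, 'k) mpoly" where "g \<in> hom_component X e"
    "primeideal (colon (poly_ring X) (monomial_span N) g) (poly_ring X)"
    by (auto simp: associated_primes_def)
  from prime_colon_degree[OF N bound this] show "total_degree f \<le> e" by simp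
qed

theorem theorem4p15:
  fixes n k :: nat and I :: "(nat, 'k::field) mpoly set"
  assumes "ideal I (poly_ring {1..n})"
    and "I \<noteq> {\<zero>\<^bsub>poly_ring {1..n}\<^esub>}"
    and "I \<noteq> carrier (poly_ring {1..n})"
    and "equigenerated {1..n} I"
    and "vertex_splittable {1..n} I"
    and "k \<ge> 1"
  shows "int (v_number {1..n} (ideal_power {1..n} I k)) = int (initial_degree {1..n} I) * int k - 1"
proof -
  let ?X = "{1..n}"
  obtain M where M: "exponent_ideal ?X M" and I: "I = monomial_span M"
    and colon: "\<And>d k. M \<noteq> {} \<Longrightarrow> 0 \<notin> M \<Longrightarrow> minimal_exponents M \<subseteq> {m. total_degree m = d} \<Longrightarrow> k \<ge> 1 \<Longrightarrow>
       \<exists>f V. variable_colon ?X (sumset_power ?X M k) f V \<and> total_degree f + 1 = d * k"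
    using vertex_splittable_variable_colon[OF assms(5)] by blast
  have "M \<noteq> {}" using assms(2) I by (auto simp: monomial_span_empty)
  have "0 \<notin> M"
  proof
    assume "0 \<in> M"
    then have "M = exponents ?X" using exponent_idealD[OF M] exponent_idealD(2)[OF M, of 0] by auto
    then show False using assms(3) I by simp
  qed
  obtain d where "min_gens ?X I \<subseteq> hom_component ?X d"
    using assms(4) unfolding equigenerated_def by blast
  then have d: "minimal_exponents M \<subseteq> {m. total_degree m = d}"
    unfolding I min_gens_subset_hom_component_iff[OF M] .
  obtain f V where fV: "variable_colon ?X (sumset_power ?X M k) f V" "total_degree f + 1 = d * k"
    using colon[OF \<open>M \<noteq> {}\<close> \<open>0 \<notin> M\<close> d assms(6)] by blast
  have nonempty: "sumset_power ?X M k \<noteq> {}"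
  proof (induction k)
    case 0
    have "0 \<in> exponents ?X" by simp
    then show ?case unfolding sumset_power.simps by blast
  next
    case (Suc k)
    obtain a b where "a \<in> sumset_power ?X M k" "b \<in> M" using Suc \<open>M \<noteq> {}\<close> by blast
    then show ?case unfolding sumset_power.simps using set_plus_intro by blast
  qed
  have "v_number ?X (monomial_span (sumset_power ?X M k) :: (nat, 'k) mpoly set) = total_degree f"
  proof (rule v_number_monomial_span[OF exponent_ideal_sumset_power[OF M] nonempty _ fV(1)])
    fix m assume "m \<in> sumset_power ?X M k"
    then show "total_degree f + 1 \<le> total_degree m"
      unfolding fV(2) by (intro sumset_power_degree_le generated_degree_le[OF M d])
  qed
  moreover have "initial_degree ?X I = d"
    unfolding I by (rule initial_degree_monomial_span[OF M \<open>M \<noteq> {}\<close> d])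
  moreover have "int (total_degree f) = int d * int k - 1"
    using arg_cong[OF fV(2), of int] by simp
  ultimately show ?thesis by (simp only: I ideal_power_monomial_span)
qed

end
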